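(* Let $\mathcal{S}=\{s_i\}_{i=1}^{\infty}$ be any infinite sequence of positive integers, and let $a, b$ be arbitrary positive integers. Then for every integer $n\ge 2$, the $n$-th reciprocal power sum $$H_{a,b}(\mathcal{S}_n)=\sum_{k=1}^{n}\frac{1}{(a+(k-1)b)^{s_k}}$$ is not an integer.
   Context: The terms $s_i$ of the sequence $\mathcal{S}$ are not necessarily distinct and not necessarily monotonic. $\mathcal{S}_n=\{s_1,\dots,s_n\}$ denotes the first $n$ terms of $\mathcal{S}$. *)

theory Defs
  imports Complex_Main
begin

(* The sequence is s 1, s 2, ...; the value s 0 is never used, and k - 1 does not
   truncate because k ranges over {1..n}. *)
definition recip_power_sum :: "nat \<Rightarrow> nat \<Rightarrow> (nat \<Rightarrow> nat) \<Rightarrow> nat \<Rightarrow> real" where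
  "recip_power_sum a b s n = (\<Sum>k = 1..n. 1 / real (a + (k - 1) * b) ^ s k)"

end

theory Submission
  imports Defs "HOL-Analysis.Harmonic_Numbers" "HOL-Computational_Algebra.Primes"
begin

text \<open>
  Write \<open>N = n - 1\<close> and let \<open>S\<close> be the sum. A prime \<open>p\<close> that divides exactly one of the bases
  \<open>a + k b\<close> with \<open>k \<le> N\<close> keeps \<open>S\<close> from being an integer, whatever the positive exponents are: after
  multiplication by all other denominators, one summand is not an integer and all others are. The
  theorem thus reduces to finding such a prime (\<open>ex_prime_dividing_one_term\<close>), or to showing that
  \<open>S\<close> cannot be an integer for reasons of size.

  Size settles all cases with few terms. If \<open>S\<close> is an integer, then \<open>S \<ge> 1\<close>, and since each exponent is
  at least 1, this forces \<open>a \<le> N\<close> and \<open>b \<le> 2 harm N\<close>, so \<open>N\<close> is exponentially large in \<open>b\<close>. A common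
  factor \<open>g\<close> of \<open>a\<close> and \<open>b\<close> is removed before \<open>p\<close> is chosen; should \<open>p\<close> divide \<open>g\<close>, then \<open>g\<close> is of
  size at least \<open>N / 2\<close> and \<open>S < 1\<close>.

  For coprime \<open>a\<close> and \<open>b \<ge> 2\<close> it is enough to find a prime \<open>p > N\<close> that divides some term, as in
  Sylvester's theorem. Suppose there is none. Let \<open>L\<close> be the least common multiple of the terms of
  index 1 to \<open>N\<close>. A product of \<open>m\<close> consecutive terms divides \<open>(m - 1)! L\<close>; applied to the last \<open>m\<close> terms
  for each \<open>m\<close>, this gives \<open>b (b + 1) ^ (N - 1) \<le> L\<close> (\<open>power_le_common_multiple\<close>). On the other hand,
  \<open>L\<close> is composed of primes up to \<open>N\<close>, and its prime powers do not exceed the largest term, so \<open>L\<close> is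
  not much larger than the product of the primes up to \<open>N\<close> (\<open>Lcm_smooth_le\<close>). A Chebyshev argument with
  the coefficients \<open>(6m)! / ((3m)! (2m)! m!)\<close> bounds that product by \<open>(7/2) ^ N\<close> (\<open>primorial_bound\<close>).
  As \<open>7/2 < 4 \<le> b + 1\<close> for \<open>b \<ge> 3\<close>, the two bounds contradict each other for large \<open>N\<close>. The condition
  on \<open>b\<close> leaves a bounded range of \<open>N\<close> for \<open>3 \<le> b \<le> 10\<close> only, and there a short chain of
  primes in each class of residues coprime to \<open>b\<close> supplies a term that is itself a prime greater than \<open>N\<close>.

  The same comparison, applied to the integers in \<open>(n, 2n]\<close>, proves Bertrand's postulate, and this
  yields the required prime for \<open>b = 1\<close> and \<open>b = 2\<close>.
\<close>

section \<open>Products of consecutive terms of a progression\<close>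

text \<open>
  The elementary substitute for a count of prime powers: if \<open>L\<close> is a common multiple of consecutive
  terms \<open>t\<^sub>u, \<dots>, t\<^sub>u\<^sub>+\<^sub>m\<close> of a progression, then their product almost divides \<open>L\<close>. In the induction
  the product of \<open>m + 2\<close> terms divides both \<open>Z \<cdot> t\<^sub>u\<close> and \<open>Z \<cdot> t\<^sub>u\<^sub>+\<^sub>m\<^sub>+\<^sub>1\<close>, where \<open>Z\<close> is the bound for
  \<open>m + 1\<close> terms, hence it divides \<open>Z\<close> times the difference \<open>(m + 1) b\<close> of these two terms.
\<close>

lemma prod_progression_dvd:
  fixes a b u m L :: nat
  assumes "\<And>k. k \<in> {u..u+m} \<Longrightarrow> a + k * b dvd L"
  shows "(\<Prod>k=u..u+m. a + k * b) dvd L * (b ^ m * fact m)"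
  using assms
proof (induction m arbitrary: u)
  case 0
  then show ?case by simp
next
  case (Suc m)
  let ?t = "\<lambda>k. a + k * b"
  let ?P = "\<Prod>k=u..u+Suc m. ?t k"
  let ?Z = "L * (b ^ m * fact m)"
  have split_last: "?P = (\<Prod>k=u..u+m. ?t k) * ?t (u + Suc m)"
    by simp
  have split_first: "?P = ?t u * (\<Prod>k=Suc u..Suc u+m. ?t k)"
    using prod.atLeast_Suc_atMost[of u "u + Suc m" ?t] by simp
  have "(\<Prod>k=u..u+m. ?t k) dvd ?Z"
    by (rule Suc.IH) (use Suc.prems in auto)
  then have 1: "?P dvd ?Z * ?t (u + Suc m)"
    unfolding split_last by (intro mult_dvd_mono) auto
  have "(\<Prod>k=Suc u..Suc u+m. ?t k) dvd ?Z"
    by (rule Suc.IH) (use Suc.prems in auto)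
  then have 2: "?P dvd ?Z * ?t u"
    unfolding split_first by (subst mult.commute) (intro mult_dvd_mono, auto)
  have "?Z * ?t (u + Suc m) - ?Z * ?t u = ?Z * (?t (u + Suc m) - ?t u)"
    by (simp only: diff_mult_distrib2)
  also have "?t (u + Suc m) - ?t u = Suc m * b"
    by (simp add: algebra_simps)
  also have "?Z * (Suc m * b) = L * (b ^ Suc m * fact (Suc m))"
    by (simp add: algebra_simps)
  finally show ?case
    using dvd_diff_nat[OF 1 2] by simp
qed

text \<open>
  Every term is coprime to \<open>b\<close>, so the power of \<open>b\<close> can be cancelled.
\<close>

lemma prod_coprime_progression_dvd:
  fixes a b u m L :: nat
  assumes "coprime a b" "\<And>k. k \<in> {u..u+m} \<Longrightarrow> a + k * b dvd L"
  shows "(\<Prod>k=u..u+m. a + k * b) dvd L * fact m"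
proof -
  have "coprime (a + k * b) b" for k
    using assms(1) by (metis add.commute coprime_iff_gcd_eq_1 gcd_add_mult mult.commute gcd.commute)
  then have "coprime (\<Prod>k=u..u+m. a + k * b) (b ^ m)"
    by (intro prod_coprime_left) simp
  moreover have "(\<Prod>k=u..u+m. a + k * b) dvd b ^ m * (L * fact m)"
    using prod_progression_dvd[of u m a b L] assms(2) by (simp add: mult_ac)
  ultimately show ?thesis
    using coprime_dvd_mult_right_iff by blast
qed

text \<open>
  Estimating each term \<open>a + k b\<close> from below by \<open>k b\<close>. The quotient \<open>(u + m)! / (u - 1)!\<close> is written
  without division, and without a truncating \<open>u - 1\<close>, by multiplying both sides by \<open>u!\<close>.
\<close>

lemma fact_quotient_le_prod_progression:
  fixes a b u m :: nat
  shows "b ^ Suc m * fact (u + m) * u \<le> (\<Prod>k=u..u+m. a + k * b) * fact u"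
proof (induction m)
  case 0
  have "b * u * fact u \<le> (a + u * b) * fact u"
    by (intro mult_right_mono) (auto simp: algebra_simps)
  then show ?case by (simp add: mult_ac)
next
  case (Suc m)
  have "b ^ Suc (Suc m) * fact (u + Suc m) * u = (b ^ Suc m * fact (u + m) * u) * (Suc (u + m) * b)"
    by (simp add: algebra_simps)
  also have "\<dots> \<le> ((\<Prod>k=u..u+m. a + k * b) * fact u) * (a + Suc (u + m) * b)"
    by (intro mult_mono Suc.IH) auto
  also have "\<dots> = (\<Prod>k=u..u+Suc m. a + k * b) * fact u"
    by (simp add: mult_ac)
  finally show ?case .
qed

text \<open>
  The two previous lemmas applied to the last \<open>m + 1\<close> terms. Which \<open>m\<close> gives the best bound does not
  matter, because all of them are summed in the next lemma.
\<close>

lemma binomial_le_common_multiple: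
  fixes a b N m L :: nat
  assumes "coprime a b" "L > 0" "m < N" and dvd: "\<And>k. k \<in> {1..N} \<Longrightarrow> a + k * b dvd L"
  shows "N * (b ^ Suc m * ((N - 1) choose m)) \<le> L"
proof -
  define u where "u = N - m"
  have u: "u > 0" "N = u + m" using assms by (auto simp: u_def)
  have "(\<Prod>k=u..u+m. a + k * b) dvd L * fact m"
    by (rule prod_coprime_progression_dvd) (use assms u in auto)
  then have le: "(\<Prod>k=u..u+m. a + k * b) \<le> L * fact m"
    using assms by (intro dvd_imp_le) auto
  obtain v where v: "u = Suc v" using u by (cases u) auto
  have "fact m * fact v * ((v + m) choose m) = (fact (v + m) :: nat)"
    using binomial_fact_lemma[of m "v + m"] by simp
  then have "b ^ Suc m * fact (u + m) * u
      = b ^ Suc m * (Suc (v + m) * (fact m * fact v * ((v + m) choose m))) * Suc v"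
    by (simp add: v)
  also have "\<dots> = (N * (b ^ Suc m * ((N - 1) choose m))) * (fact m * fact u)"
    by (simp add: u(2) v algebra_simps)
  finally have "(N * (b ^ Suc m * ((N - 1) choose m))) * (fact m * fact u)
      = b ^ Suc m * fact (u + m) * u" ..
  also have "\<dots> \<le> (L * fact m) * fact u"
    by (rule order.trans[OF fact_quotient_le_prod_progression mult_right_mono[OF le]]) simp
  finally have "(N * (b ^ Suc m * ((N - 1) choose m))) * (fact m * fact u) \<le> L * (fact m * fact u)"
    by (simp only: mult.assoc)
  then show ?thesis by simp
qed

text \<open>
  Summing the previous bound over \<open>m\<close> turns the binomial coefficients into \<open>(b + 1) ^ (N - 1)\<close>; since
  there are \<open>N\<close> summands and each carries a factor \<open>N\<close>, no polynomial factor is lost.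
\<close>

lemma power_le_common_multiple:
  fixes a b N L :: nat
  assumes "coprime a b" "L > 0" "N > 0" and dvd: "\<And>k. k \<in> {1..N} \<Longrightarrow> a + k * b dvd L"
  shows "b * (b + 1) ^ (N - 1) \<le> L"
proof -
  obtain n where n: "N = Suc n" using assms by (cases N) auto
  have "N * (b * (b + 1) ^ n) = (\<Sum>m\<le>n. N * (b ^ Suc m * (n choose m)))"
    using binomial_ring[of b 1 n] by (simp add: sum_distrib_left mult_ac)
  also have "\<dots> \<le> (\<Sum>m\<le>n. L)"
    by (intro sum_mono) (use binomial_le_common_multiple[OF assms(1,2), of _ N] dvd n in force)
  also have "\<dots> = N * L" by (simp add: n)
  finally have "N * (b * (b + 1) ^ n) \<le> N * L" .
  then show ?thesis using n by (simp only: mult_le_cancel1) simp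
qed

text \<open>
  The same idea for the integers in \<open>(n, 2n]\<close>, whose product is \<open>n!\<close> times the central binomial
  coefficient. This instance leads to Bertrand's postulate.
\<close>

lemma central_binomial_le_common_multiple:
  fixes n L :: nat
  assumes "n > 0" "L > 0" and dvd: "\<And>k. k \<in> {n<..2*n} \<Longrightarrow> k dvd L"
  shows "4 ^ n \<le> 2 * L"
proof -
  obtain m where m: "n = Suc m" using assms by (cases n) auto
  have "(\<Prod>k=Suc n..Suc n+m. 0 + k * 1) dvd L * (1 ^ m * fact m)"
    by (rule prod_progression_dvd) (use dvd m in auto)
  then have "(\<Prod>k=Suc n..Suc n+m. k) \<le> L * fact m"
    using assms by (intro dvd_imp_le) auto
  moreover have "fact n * (\<Prod>k=Suc n..Suc n+m. k) = fact (2 * n)"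
    using fact_eq_fact_times[of n "2*n"] by (simp add: m mult_2)
  ultimately have "fact (2 * n) \<le> fact n * (L * fact m)"
    by (metis mult_le_mono2)
  moreover have "fact n * fact n * (2 * n choose n) = (fact (2 * n) :: nat)"
    using binomial_fact_lemma[of n "2 * n"] by simp
  moreover have "fact n = n * fact m" by (simp add: m)
  ultimately have "(n * (2 * n choose n)) * (fact n * fact m) \<le> L * (fact n * fact m)"
    by (metis mult.assoc mult.commute)
  then have le: "n * (2 * n choose n) \<le> L" by simp
  have "4 ^ n / (2 * real n) \<le> real (2 * n choose n)"
    by (rule central_binomial_lower_bound) (use assms in simp)
  then have "4 ^ n \<le> 2 * real (n * (2 * n choose n))"
    using assms by (simp add: field_simps)
  also have "\<dots> \<le> 2 * real L" using le by (simp only: of_nat_le_iff mult_le_cancel_left) simp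
  finally have "real (4 ^ n) \<le> real (2 * L)" by simp
  then show ?thesis by (simp only: of_nat_le_iff)
qed

section \<open>A Chebyshev bound for the product of the primes up to n\<close>

definition primorial :: "nat \<Rightarrow> nat" where
  "primorial n = \<Prod>{p. prime p \<and> p \<le> n}"

lemma primorial_pos: "primorial n > 0"
  unfolding primorial_def by (intro prod_pos) (auto intro: prime_gt_0_nat)

lemma primorial_mono: "m \<le> n \<Longrightarrow> primorial m \<le> primorial n"
  using primorial_pos[of n] unfolding primorial_def
  by (intro dvd_imp_le prod_dvd_prod_subset) auto

lemma primorial_Suc: "primorial (Suc n) = (if prime (Suc n) then Suc n * primorial n else primorial n)"
proof (cases "prime (Suc n)")
  case True
  then have "{p. prime p \<and> p \<le> Suc n} = insert (Suc n) {p. prime p \<and> p \<le> n}"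
    by (auto simp: le_Suc_eq)
  then show ?thesis using True by (simp add: primorial_def)
next
  case False
  then have "{p. prime p \<and> p \<le> Suc n} = {p. prime p \<and> p \<le> n}"
    by (auto simp: le_Suc_eq)
  then show ?thesis using False by (simp add: primorial_def)
qed

lemma prod_primes_dvd:
  fixes x :: nat
  assumes "finite P" "\<And>p. p \<in> P \<Longrightarrow> prime p" "\<And>p. p \<in> P \<Longrightarrow> p dvd x"
  shows "\<Prod>P dvd x"
  using assms
proof (induction P rule: finite_induct)
  case (insert p P)
  have "coprime p (\<Prod>P)"
    using insert by (intro prod_coprime_right) (auto intro!: primes_coprime)
  then show ?case
    using insert by (simp add: divides_mult)
qed simp

lemma multiplicity_fact_Suc:
  fixes p :: nat
  assumes "prime p"
  shows "multiplicity p (fact (Suc n) :: nat) = multiplicity p (Suc n) + multiplicity p (fact n :: nat)"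
  using prime_elem_multiplicity_mult_distrib[of p "Suc n" "fact n"] assms by simp

text \<open>
  Legendre's formula is needed only in two weak forms: as a lower bound that counts the multiples of
  \<open>p\<close>, and as an equality in the range where no higher power of \<open>p\<close> contributes.
\<close>

lemma multiplicity_fact_ge:
  fixes p :: nat
  assumes "prime p"
  shows "n div p \<le> multiplicity p (fact n :: nat)"
proof (induction n)
  case (Suc n)
  have "p dvd Suc n \<Longrightarrow> 1 \<le> multiplicity p (Suc n)"
    using assms by (intro multiplicity_geI) (auto dest: prime_gt_1_nat)
  then show ?case
    using Suc by (auto simp: multiplicity_fact_Suc[OF assms] div_Suc dvd_eq_mod_eq_0 simp del: fact_Suc)
qed simp

lemma multiplicity_fact_less_square:
  fixes p :: nat
  assumes "prime p" "n < p ^ 2"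
  shows "multiplicity p (fact n :: nat) = n div p"
  using assms(2)
proof (induction n)
  case (Suc n)
  have "multiplicity p (Suc n) = (if p dvd Suc n then 1 else 0)"
  proof (cases "p dvd Suc n")
    case True
    have "\<not> p ^ 2 dvd Suc n" using Suc.prems by (meson dvd_imp_le not_less zero_less_Suc)
    then show ?thesis using True by (intro multiplicity_eqI) (auto simp: power2_eq_square)
  qed (simp add: not_dvd_imp_multiplicity_0)
  then show ?case
    using Suc by (auto simp: multiplicity_fact_Suc[OF assms(1)] div_Suc dvd_eq_mod_eq_0 simp del: fact_Suc)
qed simp

lemma trinomial_eq:
  "(6 * m choose (3 * m)) * (3 * m choose m) * (fact (3 * m) * fact (2 * m) * fact m) = (fact (6 * m) :: nat)"
proof -
  have 1: "fact (3 * m) * fact (3 * m) * (6 * m choose (3 * m)) = (fact (6 * m) :: nat)"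
    using binomial_fact_lemma[of "3 * m" "6 * m"] by simp
  have 2: "fact m * fact (2 * m) * (3 * m choose m) = (fact (3 * m) :: nat)"
    using binomial_fact_lemma[of m "3 * m"] by simp
  have "X * Y * (F * G * H) = F * (H * G * Y) * X" for X Y F G H :: nat
    by (simp add: mult_ac)
  then have "(6 * m choose (3 * m)) * (3 * m choose m) * (fact (3 * m) * fact (2 * m) * fact m)
      = fact (3 * m) * (fact m * fact (2 * m) * (3 * m choose m)) * (6 * m choose (3 * m))" .
  also have "\<dots> = fact (6 * m)" by (simp only: 1 2)
  finally show ?thesis .
qed

text \<open>
  The trinomial coefficient \<open>(6m)! / ((3m)! (2m)! m!)\<close> grows by a factor of at most
  \<open>6\<^sup>6 / (3\<^sup>3 \<cdot> 2\<^sup>2) = 432\<close> when \<open>m\<close> increases by one.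
\<close>

lemma fact_6_le: "fact (6 * m) \<le> 432 ^ m * (fact (3 * m) * fact (2 * m) * fact m :: nat)"
proof (induction m)
  case (Suc m)
  \<comment> \<open>cancelling the factors \<open>3(m+1)\<close>, \<open>2(m+1)\<close>, \<dots> that both sides share leaves one quadratic inequality\<close>
  have rearrange: "6*x * (u * (2*y * (3*z * (2*w * (v * F)))))
      \<le> 432 * P * ((3*x * (y * (w * A))) * (2*x * (z * B)) * (x * C))"
    if "v * u * F \<le> 36 * x ^ 2 * (P * (A * B * C))" for u v w x y z A B C F P :: nat
    using mult_le_mono2[OF that, of "72 * x * y * z * w"]
    by (simp add: power2_eq_square mult_ac)
  have "6 * Suc m = Suc (Suc (Suc (Suc (Suc (Suc (6 * m))))))" by simp
  then have f6: "fact (6 * Suc m) =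
      6*(m+1) * ((6*m+5) * (2*(3*m+2) * (3*(2*m+1) * (2*(3*m+1) * ((6*m+1) * (fact (6 * m) :: nat))))))"
    by (simp only: fact_Suc of_nat_id) (intro arg_cong2[of _ _ _ _ "(*)"] refl; simp)
  have "3 * Suc m = Suc (Suc (Suc (3 * m)))" by simp
  then have f3: "fact (3 * Suc m) = 3*(m+1) * ((3*m+2) * ((3*m+1) * (fact (3 * m) :: nat)))"
    by (simp only: fact_Suc of_nat_id) (intro arg_cong2[of _ _ _ _ "(*)"] refl; simp)
  have "2 * Suc m = Suc (Suc (2 * m))" by simp
  then have f2: "fact (2 * Suc m) = 2*(m+1) * ((2*m+1) * (fact (2 * m) :: nat))"
    by (simp only: fact_Suc of_nat_id) (intro arg_cong2[of _ _ _ _ "(*)"] refl; simp)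
  have "(6*m+1)*(6*m+5) \<le> 36 * (m+1)^2"
    by (simp add: power2_eq_square algebra_simps)
  then have "(6*m+1)*(6*m+5) * fact (6 * m)
      \<le> 36 * (m+1)^2 * (432 ^ m * (fact (3 * m) * fact (2 * m) * fact m))"
    by (rule mult_mono[OF _ Suc.IH]) auto
  then have "fact (6 * Suc m) \<le> 432 * 432 ^ m * (fact (3 * Suc m) * fact (2 * Suc m) * ((m+1) * fact m))"
    unfolding f6 f3 f2 by (rule rearrange)
  then show ?case by simp
qed simp

lemma trinomial_le: "(6 * m choose (3 * m)) * (3 * m choose m) \<le> 432 ^ m"
proof -
  have "(6 * m choose (3 * m)) * (3 * m choose m) * (fact (3 * m) * fact (2 * m) * fact m)
      \<le> 432 ^ m * (fact (3 * m) * fact (2 * m) * fact m :: nat)"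
    unfolding trinomial_eq by (rule fact_6_le)
  then show ?thesis by simp
qed

text \<open>
  For a prime \<open>p\<close> in \<open>(m, 6m]\<close> put \<open>q = 6m div p\<close>. The exponent of \<open>p\<close> in the trinomial coefficient is
  at least \<open>q - q div 2 - q div 3 - q div 6\<close>, and this is positive for each \<open>q\<close> from 1 to 5. A
  binomial coefficient \<open>(2m choose m)\<close> would only capture the primes up to twice its lower index;
  reaching a factor of six is what improves the constant from 4 to \<open>7/2\<close>.
\<close>

lemma prime_dvd_trinomial:
  fixes p m :: nat
  assumes p: "prime p" and "m < p" "p \<le> 6 * m"
  shows "p dvd (6 * m choose (3 * m)) * (3 * m choose m)"
proof -
  let ?v = "multiplicity p" and ?Q = "(6 * m choose (3 * m)) * (3 * m choose m)"
  define q where "q = 6 * m div p"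
  have sq: "3 * m < p ^ 2"
  proof -
    have "(m + 1) ^ 2 \<le> p ^ 2" using assms by (intro power_mono) auto
    moreover have "3 * m < (m + 1) ^ 2"
      by (cases m) (auto simp: power2_eq_square algebra_simps)
    ultimately show ?thesis by linarith
  qed
  have quot: "c * (m * d) div p div c = m * d div p" if "c > 0" for c d
    by (metis div_mult2_eq div_mult_mult1 mult.commute not_less_zero that)
  have "?v (fact (3 * m)) = q div 2"
    using multiplicity_fact_less_square[OF p sq] quot[of 2 3] by (simp add: q_def mult.commute)
  moreover have "?v (fact (2 * m)) = q div 3"
    using multiplicity_fact_less_square[OF p, of "2 * m"] sq quot[of 3 2] by (simp add: q_def mult.commute)
  moreover have "?v (fact m) = q div 6"
    using multiplicity_fact_less_square[OF p, of m] sq quot[of 6 1] by (simp add: q_def mult.commute)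
  moreover have "?v (fact (6 * m)) = ?v ?Q + (?v (fact (3 * m)) + ?v (fact (2 * m)) + ?v (fact m))"
    unfolding trinomial_eq[of m, symmetric] using p
    by (simp add: prime_elem_multiplicity_mult_distrib)
  ultimately have eq: "?v (fact (6 * m)) = ?v ?Q + (q div 2 + q div 3 + q div 6)" by (simp only:)
  have le: "q \<le> ?v (fact (6 * m))"
    unfolding q_def by (rule multiplicity_fact_ge[OF p])
  have "1 \<le> q" using assms prime_gt_0_nat[OF p] by (simp add: q_def div_greater_zero_iff Suc_le_eq)
  moreover have "q < 6" unfolding q_def using assms by (intro less_mult_imp_div_less) simp
  ultimately have "q \<in> {1, 2, 3, 4, 5}" by auto
  then have lt: "q div 2 + q div 3 + q div 6 < q" by auto
  have "?v ?Q \<noteq> 0"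
  proof
    assume "?v ?Q = 0"
    then have "q \<le> q div 2 + q div 3 + q div 6" using le unfolding eq by (simp only: add_0)
    then have "\<not> q div 2 + q div 3 + q div 6 < q" by (rule leD)
    then show False using lt by contradiction
  qed
  then show ?thesis by (rule contrapos_np) (rule not_dvd_imp_multiplicity_0)
qed

lemma primorial_6_le: "primorial (6 * m) \<le> primorial m * 432 ^ m"
proof -
  let ?P = "{p. prime p \<and> m < p \<and> p \<le> 6 * m}"
  have "{p. prime p \<and> p \<le> 6 * m} = {p. prime p \<and> p \<le> m} \<union> ?P" by auto
  then have "primorial (6 * m) = primorial m * \<Prod>?P"
    unfolding primorial_def by (simp add: prod.union_disjoint disjoint_iff)
  moreover have "\<Prod>?P dvd (6 * m choose (3 * m)) * (3 * m choose m)"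
    by (rule prod_primes_dvd) (auto intro: prime_dvd_trinomial)
  then have "\<Prod>?P \<le> (6 * m choose (3 * m)) * (3 * m choose m)"
    by (rule dvd_imp_le) simp
  then have "\<Prod>?P \<le> 432 ^ m" using trinomial_le[of m] by linarith
  ultimately show ?thesis by simp
qed

text \<open>
  The recursion in a form that the simplifier can run on numerals.
\<close>

lemma primorial_numeral:
  "primorial (numeral k) =
    (if prime (numeral k :: nat) then numeral k * primorial (pred_numeral k) else primorial (pred_numeral k))"
  using primorial_Suc[of "pred_numeral k"] by (simp only: numeral_eq_Suc)

lemma primorial_1: "primorial (Suc 0) = 1"
proof -
  have "{p::nat. prime p \<and> p \<le> Suc 0} = {}" by (auto dest: prime_gt_1_nat)
  then show ?thesis by (simp only: primorial_def prod.empty)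
qed

text \<open>
  The values at finitely many points settle small \<open>n\<close>: on an interval it suffices to compare the
  product at the right end with the power at the left end.
\<close>

lemma primorial_bound_interval:
  assumes "primorial h \<le> V" "real V \<le> (7/2) ^ l" "l \<le> n" "n \<le> h"
  shows "real (primorial n) \<le> (7/2) ^ n"
proof -
  have "real (primorial n) \<le> real V"
    using primorial_mono[OF assms(4)] assms(1) by linarith
  also have "\<dots> \<le> (7/2) ^ n"
    using assms(2) power_increasing[OF assms(3), of "7/2 :: real"] by linarith
  finally show ?thesis .
qed

text \<open>
  One step of the recursion from \<open>n\<close> to \<open>m = \<lceil>n / 6\<rceil>\<close>. Rounding up costs at most the factor
  \<open>(7/2) ^ 5\<close>, which the gap between \<open>432 \<cdot> 7/2 = 1512\<close> and \<open>(7/2) ^ 6 > 1838\<close> absorbs for large \<open>m\<close>.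
\<close>

lemma primorial_bound_sixfold:
  assumes "real (primorial h) \<le> V" "V * (7/2) ^ 5 \<le> ((7/2) ^ 6 / 432) ^ l"
    and "l \<le> m" "m \<le> h" and n: "n \<le> 6 * m" "6 * m \<le> n + 5"
  shows "real (primorial n) \<le> (7/2) ^ n"
proof -
  have "real (primorial n) \<le> real (primorial m * 432 ^ m)"
    using primorial_mono[OF n(1)] primorial_6_le[of m] by linarith
  also have "\<dots> \<le> V * 432 ^ m"
    using primorial_mono[OF assms(4)] assms(1) by simp
  finally have 1: "real (primorial n) * (7/2) ^ 5 \<le> V * (7/2) ^ 5 * 432 ^ m" by simp
  have "V * (7/2) ^ 5 \<le> ((7/2) ^ 6 / 432) ^ m"
    by (rule order.trans[OF assms(2) power_increasing[OF assms(3)]]) (simp add: power_divide)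
  then have "V * (7/2) ^ 5 * 432 ^ m \<le> ((7/2) ^ 6 / 432) ^ m * 432 ^ m"
    by (rule mult_right_mono) simp
  also have "\<dots> = ((7/2) ^ 6) ^ m" by (simp only: power_mult_distrib[symmetric]) simp
  also have "\<dots> = (7/2) ^ (6 * m)" by (rule power_mult[symmetric])
  also have "\<dots> \<le> (7/2) ^ (n + 5)" using n(2) by (intro power_increasing) auto
  also have "\<dots> = (7/2) ^ n * (7/2) ^ 5" by (rule power_add)
  finally have "real (primorial n) * (7/2) ^ 5 \<le> (7/2) ^ n * (7/2) ^ 5"
    using 1 by (rule order.trans[rotated])
  then show ?thesis by (rule mult_right_le_imp_le) simp
qed

text \<open>
  The exact growth rate of the primorial has base \<open>e\<close>. What is used later is that the base
  \<open>7/2\<close> is strictly smaller than 4: with the familiar bound \<open>4 ^ n\<close> the comparison with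
  \<open>(b + 1) ^ N\<close> would fail for \<open>b = 3\<close>, and so would the proof of Bertrand's postulate below.
\<close>

lemma primorial_bound: "real (primorial n) \<le> (7/2) ^ n"
proof (induction n rule: less_induct)
  case (less n)
  note vals = primorial_numeral primorial_1 power_divide
  show ?case
  proof (cases "n \<le> 48")
    case True
    consider "n \<le> 1" | "2 \<le> n \<and> n \<le> 4" | "5 \<le> n \<and> n \<le> 10" | "11 \<le> n \<and> n \<le> 18"
      | "19 \<le> n \<and> n \<le> 30" | "31 \<le> n \<and> n \<le> 46" | "47 \<le> n \<and> n \<le> 48"
      using True by linarith
    then show ?thesis
    proof cases
      case 1
      then show ?thesis by (intro primorial_bound_interval[of 1 1 0]) (auto simp: primorial_1)
    next
      case 2
      then show ?thesis
        by (intro primorial_bound_interval[of 4 6 2]) (auto simp: vals)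
    next
      case 3
      then show ?thesis
        by (intro primorial_bound_interval[of 10 210 5]) (auto simp: vals)
    next
      case 4
      then show ?thesis
        by (intro primorial_bound_interval[of 18 510510 11]) (auto simp: vals)
    next
      case 5
      then show ?thesis
        by (intro primorial_bound_interval[of 30 6469693230 19]) (auto simp: vals)
    next
      case 6
      then show ?thesis
        by (intro primorial_bound_interval[of 46 13082761331670030 31]) (auto simp: vals)
    next
      case 7
      then show ?thesis
        by (intro primorial_bound_interval[of 48 614889782588491410 47]) (auto simp: vals)
    qed
  next
    case False
    define m where "m = (n + 5) div 6"
    have m: "9 \<le> m" "n \<le> 6 * m" "6 * m \<le> n + 5" "m < n" using False unfolding m_def by linarith+
    note bound = primorial_bound_sixfold[OF _ _ _ _ m(2,3)]
  \<comment> \<open>for \<open>m \<le> 32\<close> the bound \<open>(7/2) ^ m\<close> is too weak, so actual values are used\<close>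
    consider "m \<le> 10" | "11 \<le> m \<and> m \<le> 12" | "13 \<le> m \<and> m \<le> 16" | "17 \<le> m \<and> m \<le> 22"
      | "23 \<le> m \<and> m \<le> 32" | "33 \<le> m"
      by linarith
    then show ?thesis
    proof cases
      case 1
      then show ?thesis using m(1) by (intro bound[of 10 210 9]) (auto simp: vals)
    next
      case 2
      then show ?thesis by (intro bound[of 12 2310 11]) (auto simp: vals)
    next
      case 3
      then show ?thesis by (intro bound[of 16 30030 13]) (auto simp: vals)
    next
      case 4
      then show ?thesis by (intro bound[of 22 9699690 17]) (auto simp: vals)
    next
      case 5
      then show ?thesis by (intro bound[of 32 200560490130 23]) (auto simp: vals)
    next
      case 6
      have "(7/2 :: real) ^ 5 \<le> ((7/2) ^ 6 / 432 / (7/2)) ^ 33" by (simp add: power_divide)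
      also have "\<dots> \<le> ((7/2) ^ 6 / 432 / (7/2)) ^ m"
        using 6 by (intro power_increasing) (auto simp: power_divide)
      also have "\<dots> = ((7/2) ^ 6 / 432) ^ m / (7/2) ^ m" by (rule power_divide)
      finally have "(7/2 :: real) ^ 5 * (7/2) ^ m \<le> ((7/2) ^ 6 / 432) ^ m"
        by (subst (asm) pos_le_divide_eq) simp_all
      then have "(7/2) ^ m * (7/2 :: real) ^ 5 \<le> ((7/2) ^ 6 / 432) ^ m"
        by (simp only: mult.commute)
      then show ?thesis by (intro bound[OF less.IH[OF m(4)]]) auto
    qed
  qed
qed

section \<open>The least common multiple of a set of smooth numbers\<close>

lemma prime_power_dvd_Lcm:
  fixes T :: "nat set"
  assumes "finite T" "0 \<notin> T" "prime p" "p ^ e dvd Lcm T" "e > 0"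
  shows "\<exists>t\<in>T. p ^ e dvd t"
  using assms
proof (induction T rule: finite_induct)
  case empty
  then show ?case by simp
next
  case (insert t T)
  have nz: "t \<noteq> 0" "Lcm T \<noteq> 0" using insert by (auto simp: Lcm_0_iff)
  have "p ^ e dvd lcm t (Lcm T)" using insert.prems by simp
  then have "e \<le> max (multiplicity p t) (multiplicity p (Lcm T))"
    using nz insert.prems multiplicity_lcm[OF nz, of p]
    by (metis multiplicity_geI multiplicity_lcm lcm_eq_0_iff not_prime_unit prime_imp_prime_elem)
  then have "p ^ e dvd t \<or> p ^ e dvd Lcm T"
    by (auto simp: le_max_iff_disj intro: multiplicity_dvd')
  then show ?case using insert by auto
qed

text \<open>
  All primes but 2 are odd.
\<close>

lemma card_primes_le: "card {p::nat. prime p \<and> p \<le> r} \<le> (r + 1) div 2"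
proof -
  have "inj_on (\<lambda>p. (p - 1) div 2) {p::nat. prime p \<and> p \<le> r}"
  proof (rule inj_onI)
    fix p q :: nat
    assume pq: "p \<in> {p. prime p \<and> p \<le> r}" "q \<in> {p. prime p \<and> p \<le> r}" "(p - 1) div 2 = (q - 1) div 2"
    have "p \<ge> 2" "q \<ge> 2" using pq by (auto intro: prime_ge_2_nat)
    moreover have "odd p \<or> p = 2" "odd q \<or> q = 2"
      using pq prime_odd_nat[of p] prime_odd_nat[of q] \<open>p \<ge> 2\<close> \<open>q \<ge> 2\<close>
      by (auto simp: le_less)
    ultimately show "p = q" using pq(3) by presburger
  qed
  then have "card {p::nat. prime p \<and> p \<le> r} = card ((\<lambda>p. (p - 1) div 2) ` {p. prime p \<and> p \<le> r})"
    by (rule card_image[symmetric])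
  also have "\<dots> \<le> card {..<(r + 1) div 2}"
  proof (intro card_mono subsetI)
    fix k assume "k \<in> (\<lambda>p. (p - 1) div 2) ` {p. prime p \<and> p \<le> r}"
    then obtain p where "prime p" "p \<le> r" "k = (p - 1) div 2" by auto
    then show "k \<in> {..<(r + 1) div 2}" using prime_ge_2_nat[of p] by auto
  qed simp
  finally show ?thesis by simp
qed

text \<open>
  An upper bound for the least common multiple of numbers up to \<open>M\<close> all of whose prime factors are at
  most \<open>N\<close>.
\<close>

definition smooth_lcm_bound :: "nat \<Rightarrow> nat \<Rightarrow> real" where
  "smooth_lcm_bound N M = (7/2) ^ N * sqrt (real M) powr (sqrt (real M) + 1)"

text \<open>
  A prime power that exactly divides the least common multiple divides one of the numbers, so it is at
  most \<open>M\<close>. Primes above \<open>\<surd>M\<close> therefore occur only to the first power and contribute at most the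
  primorial of \<open>N\<close>; the at most \<open>(\<surd>M + 1) / 2\<close> primes below \<open>\<surd>M\<close> contribute an additional factor
  \<open>M\<close> each.
\<close>

lemma Lcm_smooth_le:
  fixes T :: "nat set"
  assumes "finite T" "0 \<notin> T" and le: "\<And>t. t \<in> T \<Longrightarrow> t \<le> M" and "M > 0"
    and smooth: "\<And>t p. t \<in> T \<Longrightarrow> prime p \<Longrightarrow> p dvd t \<Longrightarrow> p \<le> N"
  shows "real (Lcm T) \<le> smooth_lcm_bound N M"
proof -
  define L where "L = Lcm T"
  define P where "P = prime_factors L"
  define S where "S = {p. prime p \<and> p * p \<le> M}"
  have L: "L \<noteq> 0" using assms(1,2) by (simp add: L_def Lcm_0_iff)
  have fin: "finite S"
    by (rule finite_subset[of _ "{..M}"]) (auto simp: S_def intro: order.trans[OF le_square])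
  have factor: "p \<le> N \<and> p ^ multiplicity p L \<le> p * (if p \<in> S then M else 1)" if "p \<in> P" for p
  proof -
    have p: "prime p" "p dvd L" using that by (auto simp: P_def)
    then have "0 < multiplicity p L"
      using L by (simp add: prime_multiplicity_gt_zero_iff)
    then obtain t where t: "t \<in> T" "p ^ multiplicity p L dvd t"
      using prime_power_dvd_Lcm[OF assms(1,2) p(1), of "multiplicity p L"] multiplicity_dvd[of p L]
      by (auto simp: L_def)
    have "p dvd t" using t(2) \<open>0 < multiplicity p L\<close> by (meson dvd_power dvd_trans)
    have "t > 0" using t(1) assms(2) by (metis gr0I)
    then have leM: "p ^ multiplicity p L \<le> M" using t le[OF t(1)] by (meson dvd_imp_le order.trans)
    have "p ^ multiplicity p L \<le> p * (if p \<in> S then M else 1)"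
    proof (cases "p \<in> S")
      case True
      have "M \<le> p * M" using prime_gt_0_nat[OF p(1)] by simp
      then show ?thesis using True leM by (auto intro: order.trans)
    next
      case False
      have "multiplicity p L < 2"
      proof (rule ccontr)
        assume "\<not> multiplicity p L < 2"
        then have "p ^ 2 \<le> p ^ multiplicity p L"
          using prime_gt_0_nat[OF p(1)] by (intro power_increasing) auto
        then show False using leM False p(1) by (simp add: S_def power2_eq_square)
      qed
      then have "multiplicity p L = 1" using \<open>0 < multiplicity p L\<close> by simp
      then show ?thesis using False by simp
    qed
    then show ?thesis using smooth[OF t(1) p(1) \<open>p dvd t\<close>] by simp
  qed
  have "L = (\<Prod>p\<in>P. p ^ multiplicity p L)"
    using prod_prime_factors[OF L] by (simp add: P_def)
  also have "\<dots> \<le> (\<Prod>p\<in>P. p * (if p \<in> S then M else 1))"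
    using factor by (intro prod_mono) auto
  also have "\<dots> = \<Prod>P * M ^ card (P \<inter> S)"
    by (simp add: prod.distrib prod.If_cases P_def)
  also have "\<dots> \<le> primorial N * M ^ card S"
  proof (rule mult_mono)
    have "\<Prod>P dvd primorial N"
      unfolding primorial_def using factor by (intro prod_dvd_prod_subset) (auto simp: P_def)
    then show "\<Prod>P \<le> primorial N" using primorial_pos by (rule dvd_imp_le)
    show "M ^ card (P \<inter> S) \<le> M ^ card S"
      using fin \<open>M > 0\<close> by (intro power_increasing card_mono) auto
  qed auto
  finally have "real L \<le> real (primorial N * M ^ card S)" by (simp only: of_nat_le_iff)
  then have "real L \<le> real (primorial N) * real M ^ card S" by simp
  also have "\<dots> \<le> (7/2) ^ N * (sqrt (real M) powr (sqrt (real M) + 1))"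
  proof (rule mult_mono[OF primorial_bound])
    define r where "r = nat \<lfloor>sqrt (real M)\<rfloor>"
    have "S \<subseteq> {p. prime p \<and> p \<le> r}"
    proof
      fix p assume p: "p \<in> S"
      then have "real (p * p) \<le> real M" by (simp only: S_def of_nat_le_iff mem_Collect_eq)
      then have "real p \<le> sqrt (real M)" by (intro real_le_rsqrt) (simp add: power2_eq_square)
      then show "p \<in> {p. prime p \<and> p \<le> r}" using p by (auto simp: S_def r_def le_nat_floor)
    qed
    then have "card S \<le> (r + 1) div 2"
      using card_mono[of "{p. prime p \<and> p \<le> r}" S] card_primes_le[of r] by fastforce
    then have "real (2 * card S) \<le> real r + 1" by linarith
    also have "real r \<le> sqrt (real M)" by (simp add: r_def)
    finally have exponent: "real (2 * card S) \<le> sqrt (real M) + 1" by simp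
    have "real M ^ card S = sqrt (real M) ^ (2 * card S)" by (simp add: power_mult)
    also have "\<dots> = sqrt (real M) powr real (2 * card S)"
      using \<open>M > 0\<close> by (subst powr_realpow) auto
    also have "\<dots> \<le> sqrt (real M) powr (sqrt (real M) + 1)"
      using exponent \<open>M > 0\<close> by (intro powr_mono) auto
    finally show "real M ^ card S \<le> sqrt (real M) powr (sqrt (real M) + 1)" .
  qed auto
  finally show ?thesis by (simp add: L_def smooth_lcm_bound_def)
qed

section \<open>When the lower bound for the least common multiple beats the upper bound\<close>

text \<open>
  Here \<open>c = b + 1\<close> for a progression of difference \<open>b\<close>, whose terms are at most \<open>c N\<close>, and \<open>c = 4\<close> for
  Bertrand's postulate. The factor 2 covers the loss from \<open>(b + 1) ^ N\<close> to \<open>b (b + 1) ^ (N - 1)\<close>.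
\<close>

definition outgrows :: "nat \<Rightarrow> nat \<Rightarrow> bool" where
  "outgrows c N \<longleftrightarrow> 2 * smooth_lcm_bound N (c * N) < real c ^ N"

text \<open>
  With \<open>X = \<surd>(c N)\<close> the power \<open>X ^ (X + 1)\<close> is negligible against \<open>(2c/7) ^ N\<close> once \<open>N\<close> is large; taking
  logarithms makes this quantitative. The factor 2 is absorbed by one more power of \<open>X\<close>.
\<close>

lemma outgrowsI:
  fixes c N :: nat
  defines "X \<equiv> sqrt (real (c * N))"
  assumes "c > 0" "2 \<le> X" "(X + 2) * ln X < real N * ln (2 * real c / 7)"
  shows "outgrows c N"
proof -
  have "2 * X powr (X + 1) \<le> X * X powr (X + 1)" using assms by (intro mult_right_mono) auto
  also have "\<dots> = X powr (X + 2)"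
    using assms(3) by (simp add: powr_add power2_eq_square)
  also have "\<dots> = exp ((X + 2) * ln X)" using assms(3) by (simp add: powr_def)
  also have "\<dots> < exp (real N * ln (2 * real c / 7))" using assms(4) by simp
  also have "\<dots> = (2 * real c / 7) ^ N"
    using \<open>c > 0\<close> by (simp add: exp_of_nat_mult)
  finally have "(7/2) ^ N * (2 * X powr (X + 1)) < (7/2) ^ N * (2 * real c / 7) ^ N"
    by (intro mult_strict_left_mono) auto
  also have "\<dots> = real c ^ N" by (simp flip: power_mult_distrib)
  finally show ?thesis by (simp add: outgrows_def smooth_lcm_bound_def X_def mult_ac)
qed

text \<open>
  The tangent to the logarithm at \<open>2 ^ k\<close>, with \<open>25/36\<close> as an upper estimate of \<open>ln 2\<close>. Choosing \<open>2 ^ k\<close>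
  near the critical value of \<open>X\<close> makes the condition of the previous lemma a quadratic inequality.
\<close>

lemma ln_le_tangent:
  fixes x :: real
  assumes "x > 0"
  shows "ln x \<le> real k * (25/36) + x / 2 ^ k - 1"
proof -
  have "ln x = ln (2 ^ k) + ln (x / 2 ^ k)" using assms by (simp add: ln_div)
  also have "ln (2 ^ k :: real) = real k * ln 2" by (simp add: ln_realpow)
  also have "ln (x / 2 ^ k) \<le> x / 2 ^ k - 1" using assms by (intro ln_le_minus_one) auto
  also have "real k * ln 2 \<le> real k * (25/36)" using ln2_le_25_over_36 by (intro mult_left_mono) auto
  finally show ?thesis by simp
qed

lemma outgrows_by_tangent:
  fixes c N :: nat and \<delta> :: real
  assumes "c > 0" "\<delta> * real c \<le> ln (2 * real c / 7)" and X: "2 \<le> X" "X = sqrt (real (c * N))"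
    and quad: "(X + 2) * (real k * (25/36) + X / 2 ^ k - 1) < \<delta> * X\<^sup>2"
  shows "outgrows c N"
proof (rule outgrowsI)
  have "(X + 2) * ln X \<le> (X + 2) * (real k * (25/36) + X / 2 ^ k - 1)"
    using X(1) by (intro mult_left_mono ln_le_tangent) auto
  also note quad
  also have "\<delta> * X\<^sup>2 = (\<delta> * real c) * real N" by (simp add: X(2))
  also have "\<dots> \<le> ln (2 * real c / 7) * real N" using assms(2) by (intro mult_right_mono) auto
  finally show "(sqrt (real (c * N)) + 2) * ln (sqrt (real (c * N))) < real N * ln (2 * real c / 7)"
    by (simp add: X(2) mult_ac)
qed (use assms in auto)

lemma ln_ratio_ge:
  fixes x y :: real
  assumes "0 < x" "x \<le> y"
  shows "2 * (y - x) / (x + y) \<le> ln y - ln x"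
  using ln_inverse_approx_ge[of x y] assms by (cases "x = y") auto

lemma ln_two_sevenths_ge:
  assumes "4 \<le> (c::real)"
  shows "2 * (2 * c - 7) / (2 * c + 7) \<le> ln (2 * c / 7)"
  using ln_ratio_ge[of 7 "2 * c"] assms by (simp add: ln_div add_ac)

text \<open>
  Splitting off \<open>ln 2\<close> first keeps the rational approximation sharp for larger \<open>c\<close>.
\<close>

lemma ln_two_sevenths_ge':
  assumes "7 \<le> (c::real)"
  shows "2 / 3 + 2 * (c - 7) / (c + 7) \<le> ln (2 * c / 7)"
proof -
  have "ln (2 * c / 7) = ln 2 + (ln c - ln 7)" using assms by (simp add: ln_div ln_mult)
  then show ?thesis using ln_ratio_ge[of 7 c] ln2_ge_two_thirds assms by (simp add: add_ac)
qed

text \<open>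
  The next three lemmas give explicit thresholds. In each of them \<open>\<delta>\<close> is a lower bound for
  \<open>ln (2c/7) / c\<close> and the threshold for \<open>X\<close> is slightly above the larger root of the quadratic. For
  \<open>c = 4\<close> the bases 4 and \<open>7/2\<close> are so close that the threshold is large.
\<close>

lemma outgrows_4:
  assumes "6000 \<le> N"
  shows "outgrows 4 N"
proof -
  define X where "X = sqrt (real (4 * N))"
  have X: "154.5 \<le> X" unfolding X_def using assms by (intro real_le_rsqrt) (simp add: power2_eq_square)
  have sq: "154.5 * X \<le> X\<^sup>2" using X by (simp add: power2_eq_square)
  have "(X + 2) * (real 7 * (25/36) + X / 2 ^ 7 - 1)
      = X\<^sup>2 / 128 + (7 * 25/36 - 1 + 2 / 128) * X + 2 * (7 * 25/36 - 1)"
    by (simp add: field_simps power2_eq_square)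
  also have "\<dots> < 1/30 * X\<^sup>2"
    using X sq by simp
  finally have quad: "(X + 2) * (real 7 * (25/36) + X / 2 ^ 7 - 1) < 1/30 * X\<^sup>2" .
  then show ?thesis
    using ln_two_sevenths_ge[of 4] X quad by (intro outgrows_by_tangent[of 4 "1/30" X N 7]) (auto simp: X_def)
qed

lemma outgrows_5_to_7:
  assumes "5 \<le> c" "c \<le> 7" "3700 \<le> c * N"
  shows "outgrows c N"
proof -
  define X where "X = sqrt (real (c * N))"
  have "3700 \<le> real (c * N)" using assms(3) by linarith
  then have X: "60.8 \<le> X" unfolding X_def by (intro real_le_rsqrt) (simp add: power2_eq_square)
  have sq: "60.8 * X \<le> X\<^sup>2" using X by (simp add: power2_eq_square)
  have "(X + 2) * (real 6 * (25/36) + X / 2 ^ 6 - 1)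
      = X\<^sup>2 / 64 + (6 * 25/36 - 1 + 2 / 64) * X + 2 * (6 * 25/36 - 1)"
    by (simp add: field_simps power2_eq_square)
  also have "\<dots> < 7/100 * X\<^sup>2"
    using X sq by simp
  finally have quad: "(X + 2) * (real 6 * (25/36) + X / 2 ^ 6 - 1) < 7/100 * X\<^sup>2" .
  have "c \<in> {5, 6, 7}" using assms by auto
  then have "7/100 * real c \<le> ln (2 * real c / 7)"
    using ln_two_sevenths_ge[of 5] ln_two_sevenths_ge[of 6] ln_two_sevenths_ge[of 7] by auto
  then show ?thesis
    using quad X assms(1) by (intro outgrows_by_tangent[of c "7/100" X N 6]) (auto simp: X_def)
qed

lemma outgrows_8_to_13:
  assumes "8 \<le> c" "c \<le> 13" "1636 \<le> c * N"
  shows "outgrows c N"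
proof -
  define X where "X = sqrt (real (c * N))"
  have "1636 \<le> real (c * N)" using assms(3) by linarith
  then have X: "40.44 \<le> X" unfolding X_def by (intro real_le_rsqrt) (simp add: power2_eq_square)
  have sq: "40.44 * X \<le> X\<^sup>2" using X by (simp add: power2_eq_square)
  have "(X + 2) * (real 5 * (25/36) + X / 2 ^ 5 - 1)
      = X\<^sup>2 / 32 + (5 * 25/36 - 1 + 2 / 32) * X + 2 * (5 * 25/36 - 1)"
    by (simp add: field_simps power2_eq_square)
  also have "\<dots> < 97/1000 * X\<^sup>2"
    using X sq by simp
  finally have quad: "(X + 2) * (real 5 * (25/36) + X / 2 ^ 5 - 1) < 97/1000 * X\<^sup>2" .
  have "c \<in> {8, 9, 10, 11, 12, 13}" using assms by auto
  then have "97/1000 * real c \<le> ln (2 * real c / 7)"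
    using ln_two_sevenths_ge'[of 8] ln_two_sevenths_ge'[of 9] ln_two_sevenths_ge'[of 10]
      ln_two_sevenths_ge'[of 11] ln_two_sevenths_ge'[of 12] ln_two_sevenths_ge'[of 13] by auto
  then show ?thesis
    using quad X assms(1) by (intro outgrows_by_tangent[of c "97/1000" X N 5]) (auto simp: X_def)
qed

text \<open>
  For large \<open>c\<close> no numerical threshold is needed: with \<open>y\<close> the fourth root of \<open>N\<close> one has \<open>c \<le> y\<^sup>2\<close> and
  \<open>X \<le> y\<^sup>3\<close>, so that the left side is of order \<open>y\<^sup>3 ln y\<close> and the right side of order \<open>y\<^sup>4\<close>.
\<close>

lemma outgrows_ge_14:
  assumes "14 \<le> c" "c\<^sup>2 \<le> N"
  shows "outgrows c N"
proof (rule outgrowsI)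
  define y where "y = sqrt (sqrt (real N))"
  define X where "X = sqrt (real (c * N))"
  have "(14::nat)\<^sup>2 \<le> c\<^sup>2" using assms(1) by (rule power_mono) simp
  then have N: "196 \<le> N" using assms(2) by simp
  have y4: "y ^ 4 = real N"
  proof -
    have "y ^ 4 = (y\<^sup>2)\<^sup>2" by (simp flip: power_mult)
    then show ?thesis by (simp add: y_def)
  qed
  have y: "3.7 \<le> y" unfolding y_def using N
    by (intro real_le_rsqrt) (simp add: power2_eq_square)
  have "real c \<le> y\<^sup>2"
    using assms(2) by (simp add: y_def) (metis of_nat_le_iff of_nat_power real_le_rsqrt)
  then have "real (c * N) \<le> y\<^sup>2 * y ^ 4" using y4 by (simp add: mult_right_mono)
  also have "\<dots> = (y ^ 3)\<^sup>2" by (simp flip: power_mult power_add)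
  finally have Xy: "X \<le> y ^ 3" unfolding X_def using y by (intro real_le_lsqrt) auto
  have "14 * 196 \<le> c * N" using assms(1) N by (intro mult_mono) auto
  then have "2\<^sup>2 \<le> real (c * N)" by (simp del: of_nat_mult)
  then show X2: "2 \<le> sqrt (real (c * N))" by (rule real_le_rsqrt)
  then have "0 < X" unfolding X_def by linarith
  then have "ln X \<le> ln (y ^ 3)" using Xy by (intro ln_mono)
  also have "\<dots> = 3 * ln y" using y by (simp add: ln_realpow)
  also have "\<dots> \<le> 3 * (real 2 * (25/36) + y / 2 ^ 2 - 1)"
    using y ln_le_tangent[of y 2] by simp
  finally have "ln X \<le> 3 * (real 2 * (25/36) + y / 2 ^ 2 - 1)" .
  moreover have "0 \<le> ln X" using X2 unfolding X_def by (intro ln_ge_zero) linarith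
  ultimately have "(X + 2) * ln X \<le> (y ^ 3 + 2) * (3 * (real 2 * (25/36) + y / 2 ^ 2 - 1))"
    using Xy y by (intro mult_mono add_right_mono) auto
  also have "\<dots> = 3/4 * y ^ 4 + 7/6 * y ^ 3 + 3/2 * y + 7/3"
    by (simp add: field_simps power_numeral_reduce)
  also have "\<dots> < 4/3 * y ^ 4"
  proof -
    have 4: "37/10 * y ^ 3 \<le> y ^ 4"
      using mult_right_mono[of "37/10" y "y ^ 3"] y by (simp add: power_numeral_reduce)
    have "(37/10) ^ 3 \<le> y ^ 3" using y by (intro power_mono) auto
    then have 3: "50 \<le> y ^ 3" by (simp add: power_divide)
    have "(37/10)\<^sup>2 \<le> y\<^sup>2" using y by (intro power_mono) auto
    then have "10 * y \<le> y\<^sup>2 * y" using y by (intro mult_right_mono) (auto simp: power_divide)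
    then have 1: "10 * y \<le> y ^ 3" by (simp add: power_numeral_reduce)
    show ?thesis using 1 3 4 by linarith
  qed
  also have "\<dots> \<le> real N * ln (2 * real c / 7)"
  proof -
    have "4/3 \<le> 2 * ln (2::real)" using ln2_ge_two_thirds by simp
    also have "\<dots> = ln (2\<^sup>2)" by (subst ln_realpow) auto
    also have "\<dots> \<le> ln (2 * real c / 7)" using assms(1) by (subst ln_le_cancel_iff) auto
    finally have "4/3 \<le> ln (2 * real c / 7)" .
    then have "4/3 * real N \<le> ln (2 * real c / 7) * real N" by (rule mult_right_mono) simp
    then show ?thesis unfolding y4 by (simp only: mult.commute)
  qed
  finally show "(sqrt (real (c * N)) + 2) * ln (sqrt (real (c * N))) < real N * ln (2 * real c / 7)"
    by (simp add: X_def)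
qed (use assms in auto)

lemma harm_le_ln:
  assumes "0 < N"
  shows "harm N \<le> 1 + ln (real N)"
proof -
  obtain n where n: "N = Suc n" using assms by (cases N) auto
  have "harm (Suc n) - ln (real (Suc n)) \<le> harm (Suc 0) - ln (real (Suc 0))"
    using decseqD[OF decseq_harm_diff_ln, of 0 n] by simp
  then show ?thesis by (simp add: n harm_expand)
qed

text \<open>
  If a harmonic number is to be as large as \<open>(c - 1) / 2\<close>, its index must be exponentially large in \<open>c\<close>.
\<close>

lemma square_le_of_harm_ge:
  assumes "14 \<le> c" "(real c - 1) / 2 \<le> harm N"
  shows "c\<^sup>2 \<le> N"
proof (rule ccontr)
  assume "\<not> c\<^sup>2 \<le> N"
  then have "harm N \<le> (harm (c\<^sup>2) :: real)" by (intro harm_mono) simp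
  also have "\<dots> \<le> 1 + ln (real (c\<^sup>2))" using assms(1) by (intro harm_le_ln) simp
  also have "\<dots> = 1 + 2 * ln (real c)" using assms(1) by (simp add: ln_realpow)
  also have "\<dots> \<le> 1 + 2 * (real 4 * (25/36) + real c / 2 ^ 4 - 1)"
    using ln_le_tangent[of "real c" 4] assms(1) by simp
  finally show False using assms by simp
qed

section \<open>Chains of primes in residue classes\<close>

text \<open>
  Primality by trial division, in a form that the simplifier evaluates. Allowing \<open>d = p\<close> makes one
  bound \<open>k\<close> usable for small and large \<open>p\<close> at the same time.
\<close>

definition trial_prime :: "nat \<Rightarrow> nat \<Rightarrow> bool" where
  "trial_prime k p \<longleftrightarrow> 1 < p \<and> p < k * k \<and> (\<forall>d\<in>set [2..<k]. p mod d = 0 \<longrightarrow> d = p)"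

lemma trial_prime_imp_prime:
  assumes "trial_prime k p"
  shows "prime p"
proof (rule ccontr)
  assume "\<not> prime p"
  then obtain d where d: "d dvd p" "d \<noteq> 1" "d \<noteq> p"
    using assms by (auto simp: trial_prime_def prime_nat_iff)
  then obtain e where e: "p = d * e" by auto
  have no: "False" if "c dvd p" "1 < c" "c < k" "c \<noteq> p" for c
    using assms that by (auto simp: trial_prime_def dvd_eq_mod_eq_0)
  have "0 < d" "0 < e" using assms e by (auto simp: trial_prime_def intro!: Nat.gr0I)
  then have gt: "1 < d" "1 < e" using d e by auto
  have "d < k \<or> e < k"
  proof (rule ccontr)
    assume "\<not> (d < k \<or> e < k)"
    then have "k * k \<le> d * e" by (intro mult_le_mono) auto
    then show False using assms e by (simp add: trial_prime_def)
  qed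
  moreover have "e \<noteq> p" "e dvd p" using e gt by auto
  ultimately show False using no[OF d(1) gt(1) _ d(3)] no[of e] gt(2) by blast
qed

text \<open>
  If every member of a list is reached from its predecessor \<open>L\<close> by a jump to at most \<open>b L + e\<close>, then
  for each \<open>N\<close> in the range covered by the list some member lies in \<open>(N, b N + e]\<close>: take the first
  one that exceeds \<open>N\<close>.
\<close>

fun growth_chain :: "nat \<Rightarrow> nat \<Rightarrow> nat \<Rightarrow> nat list \<Rightarrow> bool" where
  "growth_chain b e L [] \<longleftrightarrow> True"
| "growth_chain b e L (p # ps) \<longleftrightarrow> p \<le> b * L + e \<and> growth_chain b e p ps"

lemma growth_chain_witness:
  assumes "growth_chain b e L ps" "L \<le> N" "q \<in> set ps" "N < q"
  shows "\<exists>p\<in>set ps. N < p \<and> p \<le> b * N + e"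
  using assms
proof (induction ps arbitrary: L)
  case (Cons p ps)
  show ?case
  proof (cases "N < p")
    case True
    have "p \<le> b * L + e" using Cons.prems by simp
    also have "\<dots> \<le> b * N + e" using Cons.prems by simp
    finally show ?thesis using True by auto
  next
    case False
    then have "\<exists>p\<in>set ps. N < p \<and> p \<le> b * N + e"
      using Cons.prems by (intro Cons.IH[of p]) auto
    then show ?thesis by auto
  qed
qed simp

text \<open>
  A table holds one chain of primes for each residue class modulo \<open>b\<close> that is coprime to \<open>b\<close>. The chains
  start at \<open>L\<close> and reach \<open>U\<close>; the class of a chain is read off from its first member.
\<close>

definition chain_table :: "nat \<Rightarrow> nat \<Rightarrow> nat \<Rightarrow> nat \<Rightarrow> nat list list \<Rightarrow> bool" where
  "chain_table b k L U T \<longleftrightarrow>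
    (\<forall>r<b. (\<exists>ps\<in>set T. hd ps mod b = r) \<or> (\<exists>q\<in>set [2..<Suc b]. r mod q = 0 \<and> b mod q = 0)) \<and>
    (\<forall>ps\<in>set T. growth_chain b 1 L ps \<and> U \<le> last ps \<and> ps \<noteq> [] \<and>
      (\<forall>p\<in>set ps. trial_prime k p \<and> p mod b = hd ps mod b))"

lemma chain_table_witness:
  assumes T: "chain_table b k L U T" and "coprime a b" "b > 0" "L \<le> N" "N < U"
  shows "\<exists>p. prime p \<and> N < p \<and> p \<le> b * N + 1 \<and> p mod b = a mod b"
proof -
  have "\<forall>r<b. (\<exists>ps\<in>set T. hd ps mod b = r) \<or> (\<exists>q\<in>set [2..<Suc b]. r mod q = 0 \<and> b mod q = 0)"
    using T unfolding chain_table_def by (rule conjunct1)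
  then have "(\<exists>ps\<in>set T. hd ps mod b = a mod b) \<or>
      (\<exists>q\<in>set [2..<Suc b]. a mod b mod q = 0 \<and> b mod q = 0)"
    using mod_less_divisor[OF \<open>b > 0\<close>] by (simp only:)
  moreover have "\<not> (\<exists>q\<in>set [2..<Suc b]. a mod b mod q = 0 \<and> b mod q = 0)"
  proof
    assume "\<exists>q\<in>set [2..<Suc b]. a mod b mod q = 0 \<and> b mod q = 0"
    then obtain q where "q \<ge> 2" "a mod b mod q = 0" "b mod q = 0" by auto
    then have "q dvd a" "q dvd b" by (auto simp flip: dvd_eq_mod_eq_0 simp: dvd_mod_iff)
    then have "is_unit q" using \<open>coprime a b\<close> by (rule coprime_common_divisor[rotated])
    then show False using \<open>q \<ge> 2\<close> by simp
  qed
  ultimately have "\<exists>ps\<in>set T. hd ps mod b = a mod b" by argo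
  then obtain ps where ps: "ps \<in> set T" "hd ps mod b = a mod b" by (elim bexE)
  have "\<forall>ps\<in>set T. growth_chain b 1 L ps \<and> U \<le> last ps \<and> ps \<noteq> [] \<and>
      (\<forall>p\<in>set ps. trial_prime k p \<and> p mod b = hd ps mod b)"
    using T unfolding chain_table_def by (rule conjunct2)
  note row = bspec[OF this ps(1)]
  then have chain: "growth_chain b 1 L ps" "U \<le> last ps" "ps \<noteq> []" by simp_all
  have primes: "trial_prime k p" "p mod b = a mod b" if "p \<in> set ps" for p
    using row that unfolding ps(2) by simp_all
  obtain p where "p \<in> set ps" "N < p" "p \<le> b * N + 1"
    using growth_chain_witness[OF chain(1) \<open>L \<le> N\<close> last_in_set[OF chain(3)]] chain(2) \<open>N < U\<close> by auto
  then show ?thesis using primes[of p] trial_prime_imp_prime by blast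
qed

text \<open>
  The lower limits are those which \<open>b \<le> 2 harm N\<close> imposes on \<open>N\<close>; the upper limits are the thresholds
  for \<open>outgrows (b + 1) N\<close>.
\<close>

lemma chain_table_3:
  "chain_table 3 78 2 6000
    [[7, 19, 43, 127, 379, 1129, 3373, 6007], [5, 11, 29, 83, 239, 701, 2099, 6011]]"
  by (simp add: chain_table_def trial_prime_def) presburger

lemma chain_table_4:
  "chain_table 4 32 4 740 [[17, 61, 241, 757], [11, 43, 167, 659, 743]]"
  by (simp add: chain_table_def trial_prime_def) presburger

lemma chain_table_5:
  "chain_table 5 32 7 617
    [[31, 151, 631], [17, 67, 317, 617], [23, 113, 563, 643], [29, 139, 619]]"
  by (simp add: chain_table_def trial_prime_def) presburger

lemma chain_table_6:
  "chain_table 6 32 11 529 [[67, 397, 541], [59, 353, 563]]"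
  by (simp add: chain_table_def trial_prime_def) presburger

lemma chain_table_7:
  "chain_table 7 32 19 205 [[127, 211], [107, 233], [101, 227], [109, 263], [131, 229], [97, 223]]"
  by (simp add: chain_table_def trial_prime_def) presburger

lemma chain_table_8: "chain_table 8 32 31 182 [[193], [211], [197], [191]]"
  by (simp add: chain_table_def trial_prime_def) presburger

lemma chain_table_9: "chain_table 9 32 51 164 [[181], [173], [193], [167], [223], [179]]"
  by (simp add: chain_table_def trial_prime_def) presburger

lemma chain_table_10: "chain_table 10 32 83 149 [[151], [163], [157], [149]]"
  by (simp add: chain_table_def trial_prime_def) presburger

text \<open>
  For Bertrand's postulate: each member is less than twice its predecessor.
\<close>

definition doubling_chain :: "nat list" where
  "doubling_chain = [2, 3, 5, 7, 13, 23, 43, 83, 163, 317, 631, 1259, 2503, 5003, 6007]"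

lemma doubling_chain:
  "growth_chain 2 0 1 doubling_chain" "6007 \<in> set doubling_chain"
  "p \<in> set doubling_chain \<Longrightarrow> trial_prime 78 p"
proof -
  show "growth_chain 2 0 1 doubling_chain" "6007 \<in> set doubling_chain"
    by (simp_all add: doubling_chain_def)
  have "\<forall>p\<in>set doubling_chain. trial_prime 78 p"
    by (simp add: doubling_chain_def trial_prime_def)
  then show "trial_prime 78 p" if "p \<in> set doubling_chain" using that by (rule bspec)
qed

section \<open>Values of harmonic numbers\<close>

lemma twice_harm_less:
  "2 * harm 1 < (3::real)" "2 * harm 3 < (4::real)" "2 * harm 6 < (5::real)" "2 * harm 10 < (6::real)"
  "2 * harm 18 < (7::real)" "2 * harm 30 < (8::real)" "2 * harm 50 < (9::real)" "2 * harm 82 < (10::real)"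
  "2 * harm 136 < (11::real)"
  by (simp_all add: harm_expand)

section \<open>Primes dividing exactly one term of a progression\<close>

text \<open>
  If all prime factors of the terms were at most \<open>N\<close>, the least common multiple of the terms would have
  to satisfy both the lower and the upper bound.
\<close>

lemma ex_large_prime_divisor:
  fixes a b N :: nat
  assumes "coprime a b" "0 < b" "0 < N" "a \<le> N" and grow: "outgrows (b + 1) N"
  shows "\<exists>p k. prime p \<and> N < p \<and> k \<le> N \<and> p dvd a + k * b"
proof (rule ccontr)
  assume contra: "\<nexists>p k. prime p \<and> N < p \<and> k \<le> N \<and> p dvd a + k * b"
  define T where "T = (\<lambda>k. a + k * b) ` {1..N}"
  have T0: "finite T" "0 \<notin> T" using \<open>0 < b\<close> by (auto simp: T_def)
  have "real (Lcm T) \<le> smooth_lcm_bound N ((b + 1) * N)"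
  proof (rule Lcm_smooth_le[OF T0])
    show "t \<le> (b + 1) * N" if t: "t \<in> T" for t
    proof -
      obtain k where k: "t = a + k * b" "k \<in> {1..N}" using t unfolding T_def by blast
      then have "k * b \<le> N * b" by (intro mult_right_mono) auto
      then have "t \<le> N + N * b" using k(1) \<open>a \<le> N\<close> by (simp only: add_mono)
      then show ?thesis by (simp add: algebra_simps)
    qed
    show "p \<le> N" if "t \<in> T" "prime p" "p dvd t" for t p
      using that contra by (auto simp: T_def not_less)
  qed (use \<open>0 < N\<close> in simp)
  moreover have "(b + 1) ^ N \<le> 2 * Lcm T"
  proof -
    have "b * (b + 1) ^ (N - 1) \<le> Lcm T"
    proof (rule power_le_common_multiple[OF \<open>coprime a b\<close> _ \<open>0 < N\<close>])
      show "0 < Lcm T" using T0 by (intro Nat.gr0I) (simp add: Lcm_0_iff)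
      show "a + k * b dvd Lcm T" if "k \<in> {1..N}" for k
        using that by (intro dvd_Lcm) (auto simp: T_def)
    qed
    moreover have "(b + 1) ^ N = (b + 1) * (b + 1) ^ (N - 1)"
      using \<open>0 < N\<close> by (cases N) auto
    moreover have "(b + 1) * (b + 1) ^ (N - 1) \<le> (2 * b) * (b + 1) ^ (N - 1)"
      using \<open>0 < b\<close> by (intro mult_right_mono) auto
    ultimately show ?thesis by linarith
  qed
  then have "real (b + 1) ^ N \<le> 2 * real (Lcm T)"
    by (metis of_nat_le_iff of_nat_mult of_nat_numeral of_nat_power)
  ultimately show False using grow by (simp add: outgrows_def)
qed

text \<open>
  If \<open>(n, 2n]\<close> contained no prime, all numbers in it would have their prime factors up to \<open>n\<close>. The
  comparison is that of the case \<open>c = 4\<close>, because \<open>2n \<le> 4n\<close> and \<open>4 ^ n\<close> is the lower bound that comes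
  from the central binomial coefficient.
\<close>

lemma bertrand_postulate:
  fixes n :: nat
  assumes "0 < n"
  shows "\<exists>p. prime p \<and> n < p \<and> p \<le> 2 * n"
proof (cases "n < 6000")
  case True
  then obtain p where p: "p \<in> set doubling_chain" "n < p" "p \<le> 2 * n"
    using growth_chain_witness[OF doubling_chain(1) _ doubling_chain(2), of n] assms by auto
  then show ?thesis using trial_prime_imp_prime[OF doubling_chain(3)[OF p(1)]] by blast
next
  case False
  show ?thesis
  proof (rule ccontr)
    assume contra: "\<nexists>p. prime p \<and> n < p \<and> p \<le> 2 * n"
    define T where "T = {n<..2 * n}"
    have T0: "finite T" "0 \<notin> T" by (auto simp: T_def)
    have "real (Lcm T) \<le> smooth_lcm_bound n (4 * n)"
    proof (rule Lcm_smooth_le[OF T0])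
      show "p \<le> n" if "t \<in> T" "prime p" "p dvd t" for t p
      proof -
        have "p \<le> t" using that by (intro dvd_imp_le) (auto simp: T_def)
        then show ?thesis using that contra by (auto simp: T_def not_less)
      qed
    qed (use assms in \<open>auto simp: T_def\<close>)
    moreover have "4 ^ n \<le> 2 * Lcm T"
    proof (rule central_binomial_le_common_multiple[OF assms])
      show "0 < Lcm T" using T0 by (intro Nat.gr0I) (simp add: Lcm_0_iff)
    qed (auto simp: T_def intro!: dvd_Lcm)
    then have "real 4 ^ n \<le> 2 * real (Lcm T)"
      by (metis of_nat_le_iff of_nat_mult of_nat_numeral of_nat_power)
    ultimately show False using outgrows_4[of n] False by (simp add: outgrows_def)
  qed
qed

lemma prime_in_class_divides_term:
  fixes a b N p :: nat
  assumes "p mod b = a mod b" "a \<le> N" "N < p" "p \<le> a + N * b"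
  shows "\<exists>k\<le>N. p dvd a + k * b"
proof -
  have "b dvd p - a" using assms by (metis mod_eq_dvd_iff_nat le_trans less_imp_le)
  then obtain k where "p - a = b * k" by auto
  then have p: "p = a + k * b" using assms by (simp add: algebra_simps)
  then have "k * b \<le> N * b" using assms by simp
  then have "k \<le> N \<or> b = 0" by auto
  then show ?thesis using p assms by auto
qed

lemma less_if_harm_ge:
  assumes "2 * harm L < real b" "real b \<le> 2 * harm N"
  shows "L < N"
  using assms harm_mono[of N L, where 'a = real] by (cases "N \<le> L") auto

text \<open>
  A theorem of Sylvester type. The hypothesis on \<open>b\<close> makes \<open>N\<close> so large that the comparison of bounds
  fails only in the finitely many cases that the tables cover. For \<open>b = 2\<close> the terms run through the odd numbers up to at least \<open>2 N\<close>, and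
  Bertrand's postulate suffices.
\<close>

lemma ex_prime_greater_dividing_term:
  fixes a b N :: nat
  assumes "coprime a b" "0 < a" "a \<le> N" "2 \<le> b" "real b \<le> 2 * harm N"
  shows "\<exists>p k. prime p \<and> N < p \<and> k \<le> N \<and> p dvd a + k * b"
proof -
  have N: "0 < N" using assms by simp
  have by_growth: ?thesis if "outgrows (b + 1) N"
    using that ex_large_prime_divisor assms N by auto
  have by_table: ?thesis if table: "chain_table b k L U T" "L \<le> N" "N < U" for k L U T
  proof -
    obtain p where p: "prime p" "N < p" "p \<le> b * N + 1" "p mod b = a mod b"
      using chain_table_witness[OF table(1) \<open>coprime a b\<close> _ table(2,3)] assms(4) by auto
    have "p \<le> a + N * b" using p(3) assms(2) by (simp add: mult.commute)
    then show ?thesis using prime_in_class_divides_term[OF p(4) assms(3) p(2)] p by blast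
  qed
  note harm_bound = less_if_harm_ge[OF _ assms(5)]
  have "b = 2 \<or> b = 3 \<or> b = 4 \<or> b = 5 \<or> b = 6 \<or> b = 7 \<or> b = 8 \<or> b = 9 \<or> b = 10
    \<or> b = 11 \<or> b = 12 \<or> 13 \<le> b"
    using assms(4) by presburger
  then consider "b = 2" | "b = 3" | "b = 4" | "b = 5" | "b = 6" | "b = 7" | "b = 8" | "b = 9" | "b = 10"
    | "b = 11" | "b = 12" | "13 \<le> b"
    by blast
  then show ?thesis
  proof cases
    case 1
    show ?thesis
    proof (cases "N = 1")
      case True
      have "a = 1" using True assms by simp
      then have "a + 1 * b = 3" using 1 by simp
      then have "prime (3::nat)" "3 dvd a + 1 * b" by simp_all
      then show ?thesis using True by (intro exI[of _ 3] exI[of _ 1]) auto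
    next
      case False
      obtain p where p: "prime p" "N < p" "p \<le> 2 * N" using bertrand_postulate[OF N] by auto
      have "odd p" using p False N by (intro prime_odd_nat) auto
      moreover have "odd a" using assms(1) 1 by simp
      ultimately have "p mod b = a mod b" using 1 by presburger
      then have "\<exists>k\<le>N. p dvd a + k * b"
        by (rule prime_in_class_divides_term) (use p assms 1 in auto)
      then show ?thesis using p by blast
    qed
  next
    case 2
    then have "2 \<le> N" using harm_bound[of 1] twice_harm_less by simp
    then show ?thesis
      using by_table[of 78 2 6000] chain_table_3 by_growth outgrows_4[of N] 2
      by (cases "N < 6000") auto
  next
    case 3
    then have "4 \<le> N" using harm_bound[of 3] twice_harm_less by simp
    then show ?thesis
      using by_table[of 32 4 740] chain_table_4 by_growth outgrows_5_to_7[of "b + 1" N] 3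
      by (cases "N < 740") auto
  next
    case 4
    then have "7 \<le> N" using harm_bound[of 6] twice_harm_less by simp
    then show ?thesis
      using by_table[of 32 7 617] chain_table_5 by_growth outgrows_5_to_7[of "b + 1" N] 4
      by (cases "N < 617") auto
  next
    case 5
    then have "11 \<le> N" using harm_bound[of 10] twice_harm_less by simp
    then show ?thesis
      using by_table[of 32 11 529] chain_table_6 by_growth outgrows_5_to_7[of "b + 1" N] 5
      by (cases "N < 529") auto
  next
    case 6
    then have "19 \<le> N" using harm_bound[of 18] twice_harm_less by simp
    then show ?thesis
      using by_table[of 32 19 205] chain_table_7 by_growth outgrows_8_to_13[of "b + 1" N] 6
      by (cases "N < 205") auto
  next
    case 7
    then have "31 \<le> N" using harm_bound[of 30] twice_harm_less by simp
    then show ?thesis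
      using by_table[of 32 31 182] chain_table_8 by_growth outgrows_8_to_13[of "b + 1" N] 7
      by (cases "N < 182") auto
  next
    case 8
    then have "51 \<le> N" using harm_bound[of 50] twice_harm_less by simp
    then show ?thesis
      using by_table[of 32 51 164] chain_table_9 by_growth outgrows_8_to_13[of "b + 1" N] 8
      by (cases "N < 164") auto
  next
    case 9
    then have "83 \<le> N" using harm_bound[of 82] twice_harm_less by simp
    then show ?thesis
      using by_table[of 32 83 149] chain_table_10 by_growth outgrows_8_to_13[of "b + 1" N] 9
      by (cases "N < 149") auto
  next
    case 10
    then have "137 \<le> N" using harm_bound[of 136] twice_harm_less by simp
    then show ?thesis using by_growth outgrows_8_to_13[of "b + 1" N] 10 by auto
  next
    case 11
    then have "137 \<le> N" using harm_bound[of 136] twice_harm_less by simp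
    then show ?thesis using by_growth outgrows_8_to_13[of "b + 1" N] 11 by auto
  next
    case 12
    have "(b + 1)\<^sup>2 \<le> N" using 12 assms(5) by (intro square_le_of_harm_ge) auto
    then show ?thesis using by_growth outgrows_ge_14[of "b + 1" N] 12 by auto
  qed
qed

text \<open>
  A prime larger than \<open>N\<close> that does not divide \<open>b\<close> divides at most one of \<open>N + 1\<close> consecutive terms. For
  \<open>b = 1\<close> such a large prime need not exist, as the terms 1, 2, 3, 4 show; but a prime in
  the upper half of \<open>[1, a + N]\<close> is a term of the progression, and its double is too large to be one.
\<close>

lemma ex_prime_dividing_one_term:
  fixes a b N :: nat
  assumes "coprime a b" "0 < a" "a \<le> N" "0 < b" "real b \<le> 2 * harm N"
  shows "\<exists>p k. prime p \<and> N + 2 \<le> 2 * p \<and> k \<le> N \<and> p dvd a + k * b \<and>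
    (\<forall>j\<le>N. p dvd a + j * b \<longrightarrow> j = k)"
proof (cases "b = 1")
  case True
  define m where "m = (a + N) div 2"
  have "0 < m" using assms by (simp add: m_def)
  then obtain p where p: "prime p" "m < p" "p \<le> 2 * m" using bertrand_postulate by blast
  have bounds: "p \<le> a + N" "a + N < 2 * p" using p by (auto simp: m_def)
  define k where "k = p - a"
  have k: "p = a + k" "k \<le> N" using bounds assms(3) by (auto simp: k_def)
  have "j = k" if j: "j \<le> N" "p dvd a + j" for j
  proof -
    obtain q where q: "a + j = p * q" using j(2) by auto
    have "q \<noteq> 0" using q assms(2) by (intro notI) simp
    moreover have "q < 2"
    proof (rule ccontr)
      assume "\<not> q < 2"
      then have "p * 2 \<le> p * q" by simp
      then show False using q j(1) bounds by linarith
    qed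
    ultimately have "q = 1" by simp
    then show ?thesis using q k by simp
  qed
  moreover have "N + 2 \<le> 2 * p" using bounds assms(2) by linarith
  moreover have "p dvd a + k" using k(1) by simp
  ultimately show ?thesis using p(1) k(2) unfolding True mult_1_right by blast
next
  case False
  then have "2 \<le> b" using assms(4) by simp
  then obtain p k where pk: "prime p" "N < p" "k \<le> N" "p dvd a + k * b"
    using ex_prime_greater_dividing_term assms by blast
  have "\<not> p dvd b"
  proof
    assume "p dvd b"
    then have "p dvd a" using pk(4) by (simp add: dvd_add_left_iff)
    then have "is_unit p" using \<open>p dvd b\<close> assms(1) by (rule coprime_common_divisor[rotated])
    then show False using pk(1) by simp
  qed
  have inj: "i = j" if "i \<le> N" "i \<le> j" "j \<le> N" "p dvd a + i * b" "p dvd a + j * b" for i j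
  proof -
    have "p dvd (a + j * b) - (a + i * b)" using that by (intro dvd_diff_nat)
    also have "(a + j * b) - (a + i * b) = (j - i) * b" using that by (simp add: diff_mult_distrib)
    finally have "p dvd j - i" using \<open>\<not> p dvd b\<close> pk(1) by (simp add: prime_dvd_mult_iff)
    then show ?thesis using that pk(2) by (auto dest: dvd_imp_le)
  qed
  have "j = k" if "j \<le> N" "p dvd a + j * b" for j
    using inj[of j k] inj[of k j] that pk(3,4) linear[of j k] by blast
  moreover have "N + 2 \<le> 2 * p" using pk(2) prime_ge_2_nat[OF pk(1)] by linarith
  ultimately show ?thesis using pk by blast
qed

section \<open>Sums of reciprocals\<close>

text \<open>
  The term divisible by \<open>p\<close> cannot be cleared by the product of the other denominators. No comparison
  of exponents enters, which is why arbitrary powers of the terms are harmless.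
\<close>

lemma sum_reciprocals_not_Ints:
  fixes y :: "'a \<Rightarrow> nat"
  assumes "finite I" "k \<in> I" and pos: "\<And>j. j \<in> I \<Longrightarrow> 0 < y j"
    and p: "prime p" "p dvd y k" and other: "\<And>j. j \<in> I \<Longrightarrow> j \<noteq> k \<Longrightarrow> \<not> p dvd y j"
  shows "(\<Sum>j\<in>I. 1 / real (y j)) \<notin> \<int>"
proof
  assume int: "(\<Sum>j\<in>I. 1 / real (y j)) \<in> \<int>"
  define J where "J = I - {k}"
  define Q where "Q = (\<Prod>j\<in>J. y j)"
  have J: "finite J" using assms by (simp add: J_def)
  have "real Q * (1 / real (y j)) \<in> \<int>" if "j \<in> J" for j
  proof -
    have "y j dvd Q" unfolding Q_def using J that by (rule dvd_prodI)
    then obtain c where "Q = y j * c" by auto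
    then have "real Q * (1 / real (y j)) = real c" using pos[of j] that by (simp add: J_def)
    then show ?thesis by simp
  qed
  then have "(\<Sum>j\<in>J. real Q * (1 / real (y j))) \<in> \<int>" by (rule Ints_sum)
  moreover have "real Q * (\<Sum>j\<in>I. 1 / real (y j)) \<in> \<int>" using int by (intro Ints_mult) auto
  moreover have "(\<Sum>j\<in>I. 1 / real (y j)) = 1 / real (y k) + (\<Sum>j\<in>J. 1 / real (y j))"
    unfolding J_def using assms(1,2) by (rule sum.remove)
  then have "real Q / real (y k) = real Q * (\<Sum>j\<in>I. 1 / real (y j)) - (\<Sum>j\<in>J. real Q * (1 / real (y j)))"
    by (simp add: algebra_simps sum_distrib_left)
  ultimately have "real Q / real (y k) \<in> \<int>" by (simp only: Ints_diff)
  then obtain z where "real Q / real (y k) = of_int z" by (auto elim: Ints_cases)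
  then have "real_of_int (int Q) = real_of_int (z * int (y k))"
    using pos[OF assms(2)] by (simp add: field_simps)
  then have "int (y k) dvd int Q" by (simp only: of_int_eq_iff) simp
  then have "p dvd Q" using p(2) by (meson dvd_trans int_dvd_int_iff)
  then obtain j where "j \<in> J" "p dvd y j"
    using prime_dvd_prod_iff[OF J p(1)] by (auto simp: Q_def)
  then show False using other by (auto simp: J_def)
qed

text \<open>
  A crude bound suffices: after the first two, each reciprocal is at most \<open>1/3\<close>.
\<close>

lemma harm_Suc_le: "0 < N \<Longrightarrow> harm (Suc N) \<le> (2 * real N + 7) / 6"
proof (induction N)
  case (Suc N)
  show ?case
  proof (cases "N = 0")
    case False
    have "inverse (real (Suc (Suc N))) \<le> inverse 3"
      using False by (intro le_imp_inverse_le) auto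
    then have "harm (Suc N) + inverse (real (Suc (Suc N))) \<le> (2 * real N + 7) / 6 + 1 / 3"
      using Suc.IH False by (intro add_mono) auto
    then have "harm (Suc (Suc N)) \<le> (2 * real N + 7) / 6 + 1 / 3"
      by (subst harm_Suc) simp
    then show ?thesis by (simp add: field_simps)
  qed (simp add: harm_Suc harm_def)
qed simp

theorem theorem1p1:
  fixes s :: "nat \<Rightarrow> nat" and a b n :: nat
  assumes "\<And>i. i \<ge> 1 \<Longrightarrow> s i > 0"
    and "a > 0" and "b > 0"
    and "n \<ge> 2"
  shows "recip_power_sum a b s n \<notin> \<int>"
proof
  assume int: "recip_power_sum a b s n \<in> \<int>"
  define N where "N = n - 1"
  define y where "y = (\<lambda>k. (a + k * b) ^ s (Suc k))"
  define S where "S = (\<Sum>k\<le>N. 1 / real (y k))"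
  have N: "0 < N" using assms by (simp add: N_def)
  have "recip_power_sum a b s n = (\<Sum>k = Suc 0..Suc N. 1 / real (a + (k - 1) * b) ^ s k)"
    using assms by (simp add: recip_power_sum_def N_def)
  also have "\<dots> = S"
    unfolding sum.shift_bounds_cl_Suc_ivl by (simp add: S_def y_def atLeast0AtMost)
  finally have S_int: "S \<in> \<int>" using int by simp
  have y_pos: "0 < y k" for k using \<open>0 < a\<close> by (simp add: y_def)
  have recip_le: "1 / real (y k) \<le> 1 / real (a + k * b)" for k
  proof -
    have "(a + k * b) ^ 1 \<le> (a + k * b) ^ s (Suc k)"
      using assms(1)[of "Suc k"] \<open>0 < a\<close> by (intro power_increasing) auto
    then have "real (a + k * b) \<le> real (y k)" by (simp only: y_def of_nat_le_iff power_one_right)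
    then show ?thesis using \<open>0 < a\<close> by (intro frac_le) (auto simp del: of_nat_add)
  qed
  have "0 < S" unfolding S_def using y_pos by (intro sum_pos) auto
  then have S_ge_1: "1 \<le> S" using S_int by (auto elim!: Ints_cases)

  have S_split: "S = 1 / real (y 0) + (\<Sum>k=1..N. 1 / real (y k))"
    unfolding S_def by (simp add: sum.atMost_shift sum.atLeast1_atMost_eq)
  have tail_pos: "0 < (\<Sum>k=1..N. 1 / real (y k))" using y_pos N by (intro sum_pos) auto
  have tail_le: "(\<Sum>k=1..N. 1 / real (y k)) \<le> harm N / real b"
  proof -
    have "1 / real (y k) \<le> inverse (real k) / real b" if "k \<in> {1..N}" for k
    proof -
      have "1 / real (a + k * b) \<le> 1 / real (k * b)"
        using that \<open>0 < b\<close> by (intro frac_le) auto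
      then show ?thesis using recip_le[of k] by (simp add: field_simps)
    qed
    then show ?thesis unfolding harm_def sum_divide_distrib by (intro sum_mono) auto
  qed

  \<comment> \<open>if \<open>a > N\<close>, each of the \<open>N + 1\<close> summands is at most \<open>1 / (N + 1)\<close>, and the second one is smaller\<close>
  have a_le: "a \<le> N"
  proof (rule ccontr)
    assume "\<not> a \<le> N"
    then have a: "N + 1 \<le> a" by simp
    have "S < (\<Sum>k\<le>N. 1 / real (N + 1))"
      unfolding S_def
    proof (rule sum_strict_mono_ex1)
      have "1 / real (a + k * b) \<le> 1 / real (N + 1)" for k
      proof -
        have "N + 1 \<le> a + k * b" using a by simp
        then have "real (N + 1) \<le> real (a + k * b)" by (simp only: of_nat_le_iff)
        then show ?thesis by (rule frac_le[rotated -1]) simp_all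
      qed
      then show "\<forall>k\<in>{..N}. 1 / real (y k) \<le> 1 / real (N + 1)"
        using recip_le order.trans by blast
      have "N + 1 < a + 1 * b" using a \<open>0 < b\<close> by simp
      then have "real (N + 1) < real (a + 1 * b)" by (simp only: of_nat_less_iff)
      then have "1 / real (a + 1 * b) < 1 / real (N + 1)" by (rule frac_less2[rotated -1]) simp_all
      then show "\<exists>k\<in>{..N}. 1 / real (y k) < 1 / real (N + 1)"
        using recip_le[of 1] N by (intro bexI[of _ 1]) auto
    qed simp
    also have "\<dots> = 1" by simp
    finally show False using S_ge_1 by simp
  qed

  \<comment> \<open>the summand of index 0 is at most \<open>1/2\<close>, or it is 1 and the integer \<open>S > 1\<close> is at least 2\<close>
  have b_le_harm: "real b \<le> 2 * harm N"
  proof (cases "a = 1")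
    case True
    then have "1 < S" using S_split tail_pos by (simp add: y_def)
    then have "2 \<le> S" using S_int by (auto elim!: Ints_cases)
    then have "1 \<le> harm N / real b" using S_split tail_le True by (simp add: y_def)
    then show ?thesis using \<open>0 < b\<close> harm_nonneg[of N, where 'a = real] by (simp add: field_simps)
  next
    case False
    have "1 / real a \<le> 1 / 2" using False \<open>0 < a\<close> by (intro frac_le) auto
    then have "1 / real (y 0) \<le> 1 / 2" using recip_le[of 0] by simp
    then have "1 / 2 \<le> harm N / real b" using S_split tail_le S_ge_1 by linarith
    then show ?thesis using \<open>0 < b\<close> by (simp add: field_simps)
  qed

  define g a' b' where "g = gcd a b" and "a' = a div g" and "b' = b div g"
  have red: "a = g * a'" "b = g * b'" by (simp_all add: g_def a'_def b'_def)
  have coprime_red: "coprime a' b'"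
    unfolding a'_def b'_def g_def using \<open>0 < a\<close> by (intro div_gcd_coprime) simp
  have pos: "0 < g" "0 < a'" "0 < b'" using red \<open>0 < a\<close> \<open>0 < b\<close> by (auto intro: Nat.gr0I)
  have le: "a' \<le> a" "b' \<le> b" by (simp_all add: a'_def b'_def)
  have le_harm: "real b' \<le> 2 * harm N" using le(2) b_le_harm by linarith
  have term_eq: "a + k * b = g * (a' + k * b')" for k using red by (simp add: algebra_simps)
  obtain p k where p: "prime p" "N + 2 \<le> 2 * p" and k: "k \<le> N" "p dvd a' + k * b'"
    and unique: "\<And>j. j \<le> N \<Longrightarrow> p dvd a' + j * b' \<Longrightarrow> j = k"
    using ex_prime_dividing_one_term[OF coprime_red pos(2) order.trans[OF le(1) a_le] pos(3)] le_harm by blast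
  show False
  proof (cases "p dvd g")
    case True
  \<comment> \<open>here \<open>p\<close> divides all terms, but then \<open>g\<close> is so large that \<open>S\<close> is less than 1\<close>
    then have "p \<le> g" using pos by (intro dvd_imp_le)
    have "1 / real (y j) \<le> inverse (real (Suc j)) / real g" for j
    proof -
      have "Suc j \<le> a' + j * b'" using pos by (cases b') auto
      then have "Suc j * g \<le> a + j * b" unfolding term_eq by (subst mult.commute) (rule mult_le_mono2)
      then have "real (Suc j * g) \<le> real (a + j * b)" by (simp only: of_nat_le_iff)
      moreover have "0 < real (Suc j * g)" using pos by (simp only: of_nat_0_less_iff) simp
      ultimately have "1 / real (a + j * b) \<le> 1 / real (Suc j * g)" by (intro frac_le) simp_all
      also have "1 / real (Suc j * g) = inverse (real (Suc j)) / real g"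
        by (simp only: of_nat_mult divide_inverse inverse_mult_distrib mult_1_left)
      finally show ?thesis using recip_le[of j] by linarith
    qed
    then have "S \<le> harm (Suc N) / real g"
      unfolding S_def harm_altdef sum_divide_distrib lessThan_Suc_atMost by (intro sum_mono)
    also have "\<dots> < 1"
    proof -
      have "2 \<le> p" using p(1) by (rule prime_ge_2_nat)
      have "harm (Suc N) < real g"
      proof (cases "N = 1")
        case True
        then show ?thesis using harm_Suc_le[of N] \<open>2 \<le> p\<close> \<open>p \<le> g\<close> by simp
      next
        case False
        then show ?thesis using harm_Suc_le[OF N] N p(2) \<open>p \<le> g\<close> by (simp add: field_simps)
      qed
      then show ?thesis using pos by simp
    qed
    finally show False using S_ge_1 by simp
  next
    case False
    have dvd_y: "p dvd y j \<longleftrightarrow> p dvd a' + j * b'" for j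
      using p(1) False assms(1)[of "Suc j"]
      by (simp add: y_def term_eq prime_dvd_power_iff prime_dvd_mult_iff)
    have "S \<notin> \<int>"
      unfolding S_def
    proof (rule sum_reciprocals_not_Ints)
      show "prime p" "p dvd y k" using p(1) k(2) dvd_y by blast+
      show "\<not> p dvd y j" if "j \<in> {..N}" "j \<noteq> k" for j
        using that unique[of j] dvd_y[of j] by blast
    qed (use y_pos k(1) in simp_all)
    then show False using S_int by simp
  qed
qed

end
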